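(* Let $\mathcal{A} := (A, *, \{\,,\,,\,\}, \alpha)$ be a Hom-Bol algebra. Then, for each integer $n \geq 0$, the $n$th derived Hom-algebra $\mathcal{A}^{(n)} := (A, *^{(n)}, \{\,,\,,\,\}^{(n)}, \alpha^{2^n})$, where $x *^{(n)} y := \alpha^{2^n-1}(x*y)$ and $\{x,y,z\}^{(n)} := \alpha^{2^{n+1}-2}(\{x,y,z\})$ for all $x,y,z\in A$, is a Hom-Bol algebra.
   Context: All vector spaces are over a fixed ground field of characteristic $0$. Binary and ternary operations are bilinear and trilinear maps respectively. For a linear self-map $\alpha$, $\alpha^k$ is the $k$-fold composition, with $\alpha^0=\mathrm{Id}$. $\circlearrowleft_{x,y,z}$ denotes the sum over cyclic permutations of $x,y,z$. A Hom-Bol algebra is a quadruple $(A, *, \{\,,\,,\,\}, \alpha)$ in which $A$ is a vector space, $*$ a binary operation and $\{\,,\,,\,\}$ a ternary operation on $A$, and $\alpha : A \to A$ a linear map such that for all $u,v,w,x,y,z \in A$: (HB1) $\alpha(x*y) = \alpha(x)*\alpha(y)$; (HB2) $\alpha(\{x,y,z\}) = \{\alpha(x),\alpha(y),\alpha(z)\}$; (HB3) $x*y = -y*x$; (HB4) $\{x,y,z\} = -\{y,x,z\}$; (HB5) $\circlearrowleft_{x,y,z}\{x,y,z\} = 0$; (HB6) $\{\alpha(x),\alpha(y),u*v\} = \{x,y,u\}*\alpha^2(v) + \alpha^2(u)*\{x,y,v\} + \{\alpha(u),\alpha(v),x*y\} - (\alpha(u)*\alpha(v))*(\alpha(x)*\alpha(y))$;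 (HB7) $\{\alpha^2(x),\alpha^2(y),\{u,v,w\}\} = \{\{x,y,u\},\alpha^2(v),\alpha^2(w)\} + \{\alpha^2(u),\{x,y,v\},\alpha^2(w)\} + \{\alpha^2(u),\alpha^2(v),\{x,y,w\}\}$. *)

theory Defs
  imports Complex_Main
begin

(* The underlying vector space is the whole type 'a, with scalar multiplication
   "scale" over the field 'k. Vector_Spaces.linear is linearity over 'k; the
   unqualified constant "linear" of Complex_Main would be linearity over the reals. *)

definition bilinear_op ::
    "('k::field \<Rightarrow> 'a::ab_group_add \<Rightarrow> 'a) \<Rightarrow> ('a \<Rightarrow> 'a \<Rightarrow> 'a) \<Rightarrow> bool"
  where "bilinear_op scale f \<longleftrightarrow>
    (\<forall>y. Vector_Spaces.linear scale scale (\<lambda>x. f x y)) \<and>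
    (\<forall>x. Vector_Spaces.linear scale scale (\<lambda>y. f x y))"

definition trilinear_op ::
    "('k::field \<Rightarrow> 'a::ab_group_add \<Rightarrow> 'a) \<Rightarrow> ('a \<Rightarrow> 'a \<Rightarrow> 'a \<Rightarrow> 'a) \<Rightarrow> bool"
  where "trilinear_op scale t \<longleftrightarrow>
    (\<forall>y z. Vector_Spaces.linear scale scale (\<lambda>x. t x y z)) \<and>
    (\<forall>x z. Vector_Spaces.linear scale scale (\<lambda>y. t x y z)) \<and>
    (\<forall>x y. Vector_Spaces.linear scale scale (\<lambda>z. t x y z))"

locale hom_bol_algebra = vector_space scale
  for scale :: "'k::field_char_0 \<Rightarrow> 'a::ab_group_add \<Rightarrow> 'a" +
  fixes mult :: "'a \<Rightarrow> 'a \<Rightarrow> 'a"  (infixl "\<odot>" 70)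
    and triple :: "'a \<Rightarrow> 'a \<Rightarrow> 'a \<Rightarrow> 'a"
    and \<alpha> :: "'a \<Rightarrow> 'a"
  assumes bilinear_mult: "bilinear_op scale mult"
    and trilinear_triple: "trilinear_op scale triple"
    and linear_twist: "Vector_Spaces.linear scale scale \<alpha>"
    and HB1: "\<alpha> (x \<odot> y) = \<alpha> x \<odot> \<alpha> y"
    and HB2: "\<alpha> (triple x y z) = triple (\<alpha> x) (\<alpha> y) (\<alpha> z)"
    and HB3: "x \<odot> y = - (y \<odot> x)"
    and HB4: "triple x y z = - triple y x z"
    and HB5: "triple x y z + triple y z x + triple z x y = 0"
    and HB6: "triple (\<alpha> x) (\<alpha> y) (u \<odot> v) =
        triple x y u \<odot> (\<alpha> ^^ 2) v + (\<alpha> ^^ 2) u \<odot> triple x y v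
        + triple (\<alpha> u) (\<alpha> v) (x \<odot> y) - (\<alpha> u \<odot> \<alpha> v) \<odot> (\<alpha> x \<odot> \<alpha> y)"
    and HB7: "triple ((\<alpha> ^^ 2) x) ((\<alpha> ^^ 2) y) (triple u v w) =
        triple (triple x y u) ((\<alpha> ^^ 2) v) ((\<alpha> ^^ 2) w)
        + triple ((\<alpha> ^^ 2) u) (triple x y v) ((\<alpha> ^^ 2) w)
        + triple ((\<alpha> ^^ 2) u) ((\<alpha> ^^ 2) v) (triple x y w)"

(* The natural-number subtractions in the exponents never truncate,
   since 2 ^ n \<ge> 1 and 2 ^ (n + 1) \<ge> 2. *)

definition derived_mult ::
    "('a \<Rightarrow> 'a \<Rightarrow> 'a) \<Rightarrow> ('a \<Rightarrow> 'a) \<Rightarrow> nat \<Rightarrow> 'a \<Rightarrow> 'a \<Rightarrow> 'a"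
  where "derived_mult mult \<alpha> n x y = (\<alpha> ^^ (2 ^ n - 1)) (mult x y)"

definition derived_triple ::
    "('a \<Rightarrow> 'a \<Rightarrow> 'a \<Rightarrow> 'a) \<Rightarrow> ('a \<Rightarrow> 'a) \<Rightarrow> nat \<Rightarrow> 'a \<Rightarrow> 'a \<Rightarrow> 'a \<Rightarrow> 'a"
  where "derived_triple triple \<alpha> n x y z = (\<alpha> ^^ (2 ^ (n + 1) - 2)) (triple x y z)"

definition derived_twist :: "('a \<Rightarrow> 'a) \<Rightarrow> nat \<Rightarrow> 'a \<Rightarrow> 'a"
  where "derived_twist \<alpha> n = \<alpha> ^^ (2 ^ n)"

end

theory Submission
  imports Defs
begin

text \<open>
  The \<open>n\<close>-th derived algebra is a Yau twist. Write \<open>\<beta> = \<alpha>\<^bsup>2^n - 1\<^esup>\<close>: the derived operations are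
  \<open>\<beta> (x * y)\<close> and \<open>\<beta>\<^sup>2 {x, y, z}\<close>, and the derived twisting map is \<open>\<beta> \<alpha>\<close>. For any endomorphism
  \<open>\<beta>\<close> of the Hom-Bol algebra that commutes with \<open>\<alpha>\<close>, this passage preserves every axiom. Give the
  binary operation weight 1, the ternary operation weight 2 and \<open>\<alpha>\<close> weight 1. Each axiom is
  homogeneous along every branch of its expression trees: from the root to a variable the weights
  add up to the same number on every branch, for instance 3 in (HB6) and 4 in (HB7). So, once \<open>\<beta>\<close>
  is pulled out through the operations, the axiom for the twisted structure is \<open>\<beta>\<close> to that power
  applied to the original axiom. Since \<open>\<alpha>\<close> is itself an endomorphism, by (HB1) and (HB2), so are
  its iterates, and \<open>\<beta> = \<alpha>\<^bsup>2^n - 1\<^esup>\<close> is an admissible choice. The exponents match because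
  \<open>2^(n+1) - 2 = 2 (2^n - 1)\<close> and \<open>2^n = (2^n - 1) + 1\<close>.
\<close>

lemma linear_funpow:
  assumes "Vector_Spaces.linear s s f"
  shows "Vector_Spaces.linear s s (f ^^ m)"
proof (induction m)
  case 0
  interpret Vector_Spaces.linear s s f by fact
  show ?case using vs1.linear_id by (simp add: id_def)
next
  case (Suc m)
  show ?case
    unfolding funpow.simps by (rule Vector_Spaces.linear_compose[OF Suc assms])
qed

lemma bilinear_op_compose:
  assumes "bilinear_op s f" "Vector_Spaces.linear s s g"
  shows "bilinear_op s (\<lambda>x y. g (f x y))"
  using assms(1) by (simp add: bilinear_op_def
      Vector_Spaces.linear_compose[OF _ assms(2), unfolded comp_def])

lemma trilinear_op_compose:
  assumes "trilinear_op s t" "Vector_Spaces.linear s s g"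
  shows "trilinear_op s (\<lambda>x y z. g (t x y z))"
  using assms(1) by (simp add: trilinear_op_def
      Vector_Spaces.linear_compose[OF _ assms(2), unfolded comp_def])

context hom_bol_algebra
begin

text \<open>
  The ternary operation is twisted twice because of (HB6): in the summand
  \<open>{x, y, u} * \<alpha>\<^sup>2 v\<close> a ternary operation stands on the branch to \<open>x\<close> where two applications of
  \<open>\<alpha>\<close> stand on the branch to \<open>v\<close>, so it has to contribute as many factors \<open>\<beta>\<close> as \<open>\<alpha>\<^sup>2\<close> does.
\<close>

theorem yau_twist:
  assumes lin: "Vector_Spaces.linear scale scale \<beta>"
    and mult: "\<And>x y. \<beta> (x \<odot> y) = \<beta> x \<odot> \<beta> y"
    and triple: "\<And>x y z. \<beta> (triple x y z) = triple (\<beta> x) (\<beta> y) (\<beta> z)"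
    and commute: "\<And>x. \<alpha> (\<beta> x) = \<beta> (\<alpha> x)"
  shows "hom_bol_algebra scale
    (\<lambda>x y. \<beta> (x \<odot> y)) (\<lambda>x y z. \<beta> (\<beta> (triple x y z))) (\<lambda>x. \<beta> (\<alpha> x))"
proof -
  interpret \<beta>: Vector_Spaces.linear scale scale \<beta> by (rule lin)
  \<comment> \<open>Oriented so that \<open>\<beta>\<close> moves towards the root of a term; both sides of a twisted axiom then
      become the same power of \<open>\<beta>\<close> applied to a side of the original axiom.\<close>
  note pull_out = mult[symmetric] triple[symmetric] commute
    \<beta>.add[symmetric] \<beta>.diff[symmetric] \<beta>.neg[symmetric]
  have lin2: "Vector_Spaces.linear scale scale (\<lambda>x. \<beta> (\<beta> x))"
    using Vector_Spaces.linear_compose[OF lin lin] by (simp add: comp_def)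
  have lin_twist: "Vector_Spaces.linear scale scale (\<lambda>x. \<beta> (\<alpha> x))"
    using Vector_Spaces.linear_compose[OF linear_twist lin] by (simp add: comp_def)
  have sq: "((\<lambda>x. \<beta> (\<alpha> x)) ^^ 2) x = \<beta> (\<beta> ((\<alpha> ^^ 2) x))" for x
    by (simp add: numeral_2_eq_2 commute)
  show ?thesis
  proof (intro hom_bol_algebra.intro hom_bol_algebra_axioms.intro vector_space_axioms, goal_cases)
    case 1
    show ?case by (rule bilinear_op_compose[OF bilinear_mult lin])
  next
    case 2
    show ?case by (rule trilinear_op_compose[OF trilinear_triple lin2])
  next
    case 3
    show ?case by (rule lin_twist)
  next
    case (4 x y)
    show ?case by (simp only: pull_out HB1)
  next
    case (5 x y z)
    show ?case by (simp only: pull_out HB2)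
  next
    case (6 x y)
    show ?case by (subst HB3) (simp only: pull_out)
  next
    case (7 x y z)
    show ?case by (subst HB4) (simp only: pull_out)
  next
    case (8 x y z)
    show ?case by (simp only: pull_out HB5 \<beta>.zero)
  next
    case (9 x y u v)
    \<comment> \<open>The right-hand side of (HB6) contains an instance of its left-hand side, and so does that
        of (HB7): a single substitution, since rewriting would not end.\<close>
    show ?case by (simp only: sq pull_out) (subst HB6, rule refl)
  next
    case (10 x y u v w)
    show ?case by (simp only: sq pull_out) (subst HB7, rule refl)
  qed
qed

lemma funpow_mult: "(\<alpha> ^^ m) (x \<odot> y) = (\<alpha> ^^ m) x \<odot> (\<alpha> ^^ m) y"
  by (induction m) (simp_all add: HB1)

lemma funpow_triple:
  "(\<alpha> ^^ m) (triple x y z) = triple ((\<alpha> ^^ m) x) ((\<alpha> ^^ m) y) ((\<alpha> ^^ m) z)"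
  by (induction m) (simp_all add: HB2)

end

theorem theorem3p5:
  fixes scale :: "'k::field_char_0 \<Rightarrow> 'a::ab_group_add \<Rightarrow> 'a"
    and mult :: "'a \<Rightarrow> 'a \<Rightarrow> 'a"
    and triple :: "'a \<Rightarrow> 'a \<Rightarrow> 'a \<Rightarrow> 'a"
    and \<alpha> :: "'a \<Rightarrow> 'a"
    and n :: nat
  assumes "hom_bol_algebra scale mult triple \<alpha>"
  shows "hom_bol_algebra scale
    (derived_mult mult \<alpha> n) (derived_triple triple \<alpha> n) (derived_twist \<alpha> n)"
proof -
  interpret hom_bol_algebra scale mult triple \<alpha> by (rule assms)
  define m :: nat where "m = 2 ^ n - 1"
  have exps: "2 ^ (n + 1) - 2 = m + m" "2 ^ n = Suc m"
    by (simp_all add: m_def)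
  have "derived_mult mult \<alpha> n = (\<lambda>x y. (\<alpha> ^^ m) (mult x y))"
    by (simp add: fun_eq_iff derived_mult_def m_def)
  moreover have "derived_triple triple \<alpha> n = (\<lambda>x y z. (\<alpha> ^^ m) ((\<alpha> ^^ m) (triple x y z)))"
    unfolding fun_eq_iff derived_triple_def exps(1) by (simp add: funpow_add)
  moreover have "derived_twist \<alpha> n = (\<lambda>x. (\<alpha> ^^ m) (\<alpha> x))"
    unfolding fun_eq_iff derived_twist_def exps(2) by (simp add: funpow_swap1)
  moreover have "hom_bol_algebra scale (\<lambda>x y. (\<alpha> ^^ m) (mult x y))
      (\<lambda>x y z. (\<alpha> ^^ m) ((\<alpha> ^^ m) (triple x y z))) (\<lambda>x. (\<alpha> ^^ m) (\<alpha> x))"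
    by (rule yau_twist[where \<beta> = "\<alpha> ^^ m"])
      (rule linear_funpow[OF linear_twist] funpow_mult funpow_triple funpow_swap1)+
  ultimately show ?thesis by simp
qed

end
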